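(* Except for the path $P_3$ on three vertices, every tree $T$ has a $4^*$-coloring such that every color class is an all-$3$-isolating set of $T$.
   Context: Graphs are finite and simple. For a graph $G$ and $S\subseteq V(G)$, $N[S]$ denotes $S$ together with all vertices adjacent to a vertex of $S$. A set $S\subseteq V(G)$ (possibly empty) is an all-$k$-isolating set of $G$ if $G-N[S]$ has no component with at least $k$ vertices. An $\ell^*$-coloring of a graph is a weak partition of its vertex set into $\ell$ independent sets (the color classes), where color classes are allowed to be empty; that is, a proper coloring with colors $1,\dots,\ell$, not all of which need be used. *)

theory Defs
  imports "Graph_Theory.Graph_Theory"
begin

text \<open>
  Finite simple graphs are the instances of the locale \<^locale>\<open>graph\<close>: finite, symmetric,
  loop-free digraphs without parallel arcs, an undirected edge being a pair of opposite arcs.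
\<close>

text \<open>
  The library's \<^const>\<open>tree\<close> is unusable for symmetric digraphs, because it counts the closed walk
  along an arc and back as a cycle.  In a simple graph, the undirected cycles are
  exactly the directed ones with at least three arcs.
\<close>

definition simple_tree :: "('a, 'b) pre_digraph \<Rightarrow> bool" where
  "simple_tree G \<longleftrightarrow> graph G \<and> connected G \<and> \<not> (\<exists>p. pre_digraph.cycle G p \<and> 3 \<le> length p)"

definition path_graph :: "nat \<Rightarrow> nat pair_pre_digraph" where
  "path_graph n =
     \<lparr> pverts = {..<n}, parcs = {(i, j). i < n \<and> j < n \<and> (j = Suc i \<or> i = Suc j)} \<rparr>"

definition closed_nbhd :: "('a, 'b) pre_digraph \<Rightarrow> 'a set \<Rightarrow> 'a set" where
  "closed_nbhd G S = S \<union> {v. \<exists>u\<in>S. u \<rightarrow>\<^bsub>G\<^esub> v}"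

text \<open>
  For a symmetric digraph the strongly connected components are the components of the
  undirected graph, and every induced subgraph of a symmetric digraph is symmetric.
\<close>

definition all_isolating :: "('a, 'b) pre_digraph \<Rightarrow> nat \<Rightarrow> 'a set \<Rightarrow> bool" where
  "all_isolating G k S \<longleftrightarrow> S \<subseteq> verts G \<and>
     \<not> (\<exists>H \<in> pre_digraph.sccs (G \<restriction> (verts G - closed_nbhd G S)). k \<le> card (verts H))"

definition independent_set :: "('a, 'b) pre_digraph \<Rightarrow> 'a set \<Rightarrow> bool" where
  "independent_set G S \<longleftrightarrow> S \<subseteq> verts G \<and> (\<forall>u\<in>S. \<forall>v\<in>S. \<not> u \<rightarrow>\<^bsub>G\<^esub> v)"

definition color_class :: "('a, 'b) pre_digraph \<Rightarrow> ('a \<Rightarrow> nat) \<Rightarrow> nat \<Rightarrow> 'a set" where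
  "color_class G c i = {v \<in> verts G. c v = i}"

definition star_coloring :: "('a, 'b) pre_digraph \<Rightarrow> nat \<Rightarrow> ('a \<Rightarrow> nat) \<Rightarrow> bool" where
  "star_coloring G l c \<longleftrightarrow>
     (\<forall>v \<in> verts G. c v \<in> {1..l}) \<and> (\<forall>i \<in> {1..l}. independent_set G (color_class G c i))"

end

theory Submission
  imports Defs
begin

text \<open>
  A component with at least three vertices contains a path on three vertices, so the colour
  classes are isolating as soon as the closed neighbourhood of every three-vertex path of the
  tree contains all four colours.

  Such a colouring is built from the top down after rooting the tree at a leaf.  Every child
  avoids the colours of its parent and its grandparent.  Two colours then remain, and one child
  of each vertex, its heir, takes the one that the great-grandparent does not have, while all
  other children take the remaining one.  So that this also makes sense near the root, every
  vertex carries an ordering of the four colours: its own, those of its next two ancestors, and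
  a spare one.  Near the root, the missing ancestors are imaginary.

  Two consequences matter.  A vertex other than the root with at least two children sees all
  colours in its closed neighbourhood, namely those of its parent, of itself, of its heir and of
  another child (\<open>colours_at_branching\<close>).  And an heir, its parent, its grandparent and its
  great-grandparent have four different colours (\<open>colours_along_chain\<close>).

  Now take a path on three vertices.  If it contains a vertex of the first kind, nothing remains
  to be shown.  Otherwise each of its vertices has at most one child, for the root is a leaf;
  hence the path descends from an ancestor to a grandchild and its vertices below the top are
  heirs.  If the top has a parent or the bottom has a child, then the second consequence applies
  to four consecutive vertices.  If neither is the case, the tree consists of these three
  vertices and is the path excluded by the hypothesis (\<open>seen_three_vertex_path\<close>).
\<close>

section \<open>Three-vertex paths in connected graphs\<close>

lemma (in wf_digraph) reachable_leaves_set: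
  assumes "u \<rightarrow>\<^sup>* v" "u \<in> A" "v \<notin> A"
  obtains a b where "a \<in> A" "b \<notin> A" "a \<rightarrow> b"
proof -
  have "v \<in> A \<or> (\<exists>a b. a \<in> A \<and> b \<notin> A \<and> a \<rightarrow> b)"
    using assms(1) by (induction rule: reachable_induct) (use assms(2) in blast)+
  then show ?thesis using assms(3) that by blast
qed

text \<open>
  An edge leaves every nonempty set of at most two vertices.  Such an edge from a single vertex,
  and then one from the two ends of that edge, together form the path.
\<close>

lemma strongly_connected_imp_three_vertex_path:
  assumes "wf_digraph H" "symmetric H" "strongly_connected H" "3 \<le> card (verts H)"
  obtains x y z where "distinct [x, y, z]" "x \<rightarrow>\<^bsub>H\<^esub> y" "y \<rightarrow>\<^bsub>H\<^esub> z"
proof -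
  interpret wf_digraph H by fact
  have escape: "\<exists>a b. a \<in> A \<and> b \<notin> A \<and> a \<rightarrow>\<^bsub>H\<^esub> b"
    if A: "A \<subseteq> verts H" "A \<noteq> {}" "finite A" "card A \<le> 2" for A
  proof -
    have "\<not> verts H \<subseteq> A"
      using A assms(4) card_mono[of A "verts H"] by auto
    then obtain u v where uv: "u \<in> A" "v \<in> verts H" "v \<notin> A" using A by blast
    then have "u \<rightarrow>\<^sup>*\<^bsub>H\<^esub> v"
      using assms(3) A by (auto simp: strongly_connected_def)
    then obtain a b where "a \<in> A" "b \<notin> A" "a \<rightarrow>\<^bsub>H\<^esub> b"
      using reachable_leaves_set uv(1,3) by metis
    then show ?thesis by blast
  qed
  have sym: "v \<rightarrow>\<^bsub>H\<^esub> u" if "u \<rightarrow>\<^bsub>H\<^esub> v" for u v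
    using that assms(2) by (auto simp: symmetric_def dest: symD)
  obtain r where r: "r \<in> verts H" using assms(3) by (auto simp: strongly_connected_def)
  obtain a where a: "a \<noteq> r" "r \<rightarrow>\<^bsub>H\<^esub> a" using escape[of "{r}"] r by auto
  have "{r, a} \<subseteq> verts H" "card {r, a} \<le> 2"
    using r a adj_in_verts by (auto simp: card_insert_if)
  then obtain b where b: "b \<notin> {r, a}" "r \<rightarrow>\<^bsub>H\<^esub> b \<or> a \<rightarrow>\<^bsub>H\<^esub> b" using escape[of "{r, a}"] by auto
  from b(2) show ?thesis
  proof
    assume "r \<rightarrow>\<^bsub>H\<^esub> b"
    then show ?thesis using that[of a r b] a b sym by auto
  next
    assume "a \<rightarrow>\<^bsub>H\<^esub> b"
    then show ?thesis using that[of r a b] a b by auto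
  qed
qed

lemma path_graph_3_isoI:
  assumes "graph G" and "verts G = {x, y, z}" "distinct [x, y, z]"
    and "x \<rightarrow>\<^bsub>G\<^esub> y" "y \<rightarrow>\<^bsub>G\<^esub> z" "\<not> x \<rightarrow>\<^bsub>G\<^esub> z"
  shows "digraph_iso G (with_proj (path_graph 3))"
proof -
  interpret graph G by fact
  define f :: "'a \<Rightarrow> nat" where "f = (\<lambda>v. if v = x then 0 else if v = y then 1 else 2)"
  define hom where "hom = \<lparr>iso_verts = f, iso_arcs = (\<lambda>e. (f (tail G e), f (head G e))),
      iso_head = snd, iso_tail = fst\<rparr>"
  have f: "f x = 0" "f y = 1" "f z = 2" using assms(3) by (auto simp: f_def)
  have inj: "inj_on f (verts G)" using f by (auto simp: inj_on_def assms(2))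
  have ends: "arcs_ends G = {(x, y), (y, x), (y, z), (z, y)}"
  proof -
    have "(u, v) \<in> {(x, y), (y, x), (y, z), (z, y)}" if "u \<rightarrow>\<^bsub>G\<^esub> v" for u v
    proof -
      have "u \<in> {x, y, z}" "v \<in> {x, y, z}" using adj_in_verts[OF that] assms(2) by auto
      moreover have "u \<noteq> v" using that no_loops by (auto simp: arcs_ends_conv)
      moreover have "v \<rightarrow>\<^bsub>G\<^esub> u" using that graph_symmetric by blast
      ultimately show ?thesis using assms(6) that by auto
    qed
    moreover have "y \<rightarrow>\<^bsub>G\<^esub> x" "z \<rightarrow>\<^bsub>G\<^esub> y" using assms(4,5) graph_symmetric by auto
    ultimately show ?thesis using assms(4,5) by auto
  qed
  have inj_arcs: "inj_on (\<lambda>e. (f (tail G e), f (head G e))) (arcs G)"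
  proof (rule inj_onI)
    fix e e' assume e: "e \<in> arcs G" "e' \<in> arcs G"
      and eq: "(f (tail G e), f (head G e)) = (f (tail G e'), f (head G e'))"
    then have "arc_to_ends G e = arc_to_ends G e'"
      using inj by (auto simp: arc_to_ends_def inj_on_eq_iff)
    then show "e = e'" using e no_multi_arcs by blast
  qed
  have "(\<lambda>e. (f (tail G e), f (head G e))) ` arcs G = map_prod f f ` arcs_ends G"
    by (auto simp: arcs_ends_def arc_to_ends_def image_image)
  also have "\<dots> = {(0, 1), (1, 0), (1, 2), (2, 1)}" by (simp add: ends f)
  also have "\<dots> = parcs (path_graph 3)" by (auto simp: path_graph_def)
  finally have arcs: "(\<lambda>e. (f (tail G e), f (head G e))) ` arcs G = parcs (path_graph 3)" .
  have verts: "f ` verts G = pverts (path_graph 3)"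
    by (auto simp: assms(2) f path_graph_def)
  have "digraph_isomorphism hom"
    using inj inj_arcs by (auto simp: digraph_isomorphism_def hom_def wf_digraph)
  moreover have "with_proj (path_graph 3) = app_iso hom G"
    using arcs verts by (simp add: app_iso_def hom_def with_proj_def)
  ultimately show ?thesis by (auto simp: digraph_iso_def)
qed

section \<open>Rooting a tree\<close>

text \<open>
  The edges are exactly the pairs of a non-root vertex and its parent.  The depth
  makes the parent function well-founded, so that induction and recursion can follow it.
\<close>

locale rooted_digraph = wf_digraph G for G :: "('a, 'b) pre_digraph" (structure) +
  fixes root :: 'a and par :: "'a \<Rightarrow> 'a" and depth :: "'a \<Rightarrow> nat"
  assumes root_in_verts: "root \<in> verts G"
    and depth_root: "depth root = 0"
    and adj_iff: "u \<rightarrow> v \<longleftrightarrow>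
      v \<in> verts G - {root} \<and> u = par v \<or> u \<in> verts G - {root} \<and> v = par u"
    and depth_par: "v \<in> verts G - {root} \<Longrightarrow> depth v = Suc (depth (par v))"
begin

lemma adj_par:
  assumes "v \<in> verts G" "v \<noteq> root"
  shows "par v \<rightarrow> v" "v \<rightarrow> par v"
  using assms adj_iff by auto

lemma par_in_verts: "v \<in> verts G \<Longrightarrow> v \<noteq> root \<Longrightarrow> par v \<in> verts G"
  using adj_par adj_in_verts by blast

lemma root_induct [consumes 1, case_names root par]:
  assumes "v \<in> verts G"
    and "P root"
    and "\<And>v. v \<in> verts G \<Longrightarrow> v \<noteq> root \<Longrightarrow> P (par v) \<Longrightarrow> P v"
  shows "P v"
  using assms(1)
proof (induction "depth v" arbitrary: v)
  case 0
  then show ?case using depth_par assms(2) by fastforce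
next
  case (Suc n)
  show ?case
  proof (cases "v = root")
    case False
    have "n = depth (par v)" using Suc.hyps Suc.prems depth_par False by simp
    then show ?thesis using Suc False assms(3) par_in_verts by blast
  qed (use assms(2) in simp)
qed

lemma root_reachable: "v \<in> verts G \<Longrightarrow> root \<rightarrow>\<^sup>* v"
proof (induction rule: root_induct)
  case root
  then show ?case using root_in_verts by simp
next
  case (par v)
  then show ?case using adj_par reachable_adj_trans by blast
qed

lemma adj_depth: "u \<rightarrow> v \<Longrightarrow> depth v = Suc (depth u) \<or> depth u = Suc (depth v)"
  using adj_iff depth_par by auto

lemma no_triangle:
  assumes "x \<rightarrow> y" "y \<rightarrow> z"
  shows "\<not> x \<rightarrow> z"
proof
  assume "x \<rightarrow> z"
  then show False using adj_depth[of x z] adj_depth[OF assms(1)] adj_depth[OF assms(2)] by arith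
qed

end

text \<open>
  Two different neighbours of a vertex outside of \<open>S\<close>, joined by a path within \<open>S\<close>, would close
  that path to a cycle.
\<close>

lemma (in graph) unique_attachment:
  assumes acyclic: "\<not> (\<exists>p. cycle p \<and> 3 \<le> length p)"
    and S: "S \<subseteq> verts G" "u \<rightarrow>\<^sup>*\<^bsub>G \<restriction> S\<^esub> v" "w \<notin> S"
    and adj: "w \<rightarrow> u" "v \<rightarrow> w"
  shows "u = v"
proof (rule ccontr)
  assume "u \<noteq> v"
  interpret S: wf_digraph "G \<restriction> S" by (rule wellformed_induce_subgraph)
  obtain p where p: "S.apath u p v" using S(2) S.reachable_apath by blast
  then have path: "apath u p v"
    using subgraph_apath_imp_apath subgraph_induce_subgraphI[OF S(1)] by blast
  have "S.awalk_verts u p = awalk_verts u p"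
    by (simp add: S.awalk_verts_conv awalk_verts_conv)
  moreover have "set (S.awalk_verts u p) \<subseteq> verts (G \<restriction> S)"
    using p unfolding S.apath_def by blast
  ultimately have "set (awalk_verts u p) \<subseteq> S" by simp
  \<comment> \<open>The path has at least one arc because its ends differ, so the cycle has at least three.\<close>
  obtain e e' where e: "e \<in> arcs G" "tail G e = w" "head G e = u"
    and e': "e' \<in> arcs G" "tail G e' = v" "head G e' = w"
    using adj by (auto simp: arcs_ends_conv)
  have walk: "awalk u (p @ [e']) w"
    using awalk_appendI[OF awalkI_apath[OF path]] arc_implies_awalk[OF e'(1)] e' by simp
  then have "awalk w (e # p @ [e']) w" using e by (simp add: awalk_Cons_iff del: awalk_append_iff)
  moreover have "distinct (tl (awalk_verts w (e # p @ [e'])))"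
  proof -
    have "tl (awalk_verts w (e # p @ [e'])) = awalk_verts u p @ [w]"
      using awalk_verts_append[OF walk] e e' by simp
    moreover have "distinct (awalk_verts u p)" using path by (simp add: apath_def)
    ultimately show ?thesis using \<open>set (awalk_verts u p) \<subseteq> S\<close> S(3) by auto
  qed
  ultimately have "cycle (e # p @ [e'])" unfolding cycle_def by blast
  moreover have "p \<noteq> []" using path \<open>u \<noteq> v\<close> by (auto simp: apath_Nil_iff)
  then have "3 \<le> length (e # p @ [e'])" by (cases p) auto
  ultimately show False using acyclic by blast
qed

lemma adj_induce_subgraph_iff:
  "u \<rightarrow>\<^bsub>G \<restriction> S\<^esub> v \<longleftrightarrow> u \<rightarrow>\<^bsub>G\<^esub> v \<and> u \<in> S \<and> v \<in> S"
  by (auto simp: arcs_ends_conv)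

lemma (in graph) extend_rooting:
  assumes acyclic: "\<not> (\<exists>p. cycle p \<and> 3 \<le> length p)"
    and S: "S \<subseteq> verts G" "rooted_digraph (G \<restriction> S) r par depth"
    and w: "u \<in> S" "w \<notin> S" "u \<rightarrow> w"
  shows "rooted_digraph (G \<restriction> insert w S) r (par(w := u)) (depth(w := Suc (depth u)))"
proof -
  interpret S: rooted_digraph "G \<restriction> S" r par depth by fact
  have "symmetric (G \<restriction> S)"
    using induced_graph_imp_symmetric[OF sym_arcs induced_induce[OF S(1)]] .
  then have reach: "a \<rightarrow>\<^sup>*\<^bsub>G \<restriction> S\<^esub> b" if "a \<in> S" "b \<in> S" for a b
    using that S.root_reachable symmetric_reachable S.reachable_trans
    by (metis induce_subgraph_verts)
  have only: "v = u" if "v \<in> S" "v \<rightarrow> w" for v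
    using unique_attachment[OF acyclic S(1) reach w(2)] that w graph_symmetric by blast
  have r: "r \<in> S" using S.root_in_verts by simp
  have parS: "par v \<in> S" if "v \<in> S" "v \<noteq> r" for v
    using S.par_in_verts that by simp
  have loop: "\<not> w \<rightarrow> w" using no_loops by (auto simp: arcs_ends_conv)
  have old: "a \<rightarrow> b \<longleftrightarrow> b \<in> S - {r} \<and> a = par b \<or> a \<in> S - {r} \<and> b = par a"
    if "a \<in> S" "b \<in> S" for a b
    using S.adj_iff[of a b] that by (simp add: adj_induce_subgraph_iff)
  have new: "a \<rightarrow> w \<longleftrightarrow> a = u" "w \<rightarrow> a \<longleftrightarrow> a = u" if "a \<in> S" for a
    using only[OF that] w(3) graph_symmetric by blast+
  show ?thesis
  proof (intro rooted_digraph.intro rooted_digraph_axioms.intro)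
    show "wf_digraph (G \<restriction> insert w S)" by (rule wellformed_induce_subgraph)
    show "r \<in> verts (G \<restriction> insert w S)" using r by simp
    show "(depth(w := Suc (depth u))) r = 0" using r w S.depth_root by auto
  next
    fix a b
    show "a \<rightarrow>\<^bsub>G \<restriction> insert w S\<^esub> b \<longleftrightarrow>
        b \<in> verts (G \<restriction> insert w S) - {r} \<and> a = (par(w := u)) b \<or>
        a \<in> verts (G \<restriction> insert w S) - {r} \<and> b = (par(w := u)) a"
      unfolding adj_induce_subgraph_iff induce_subgraph_verts
      using old[of a b] new[of a] new[of b] loop parS[of a] parS[of b] r w by auto
  next
    fix v assume "v \<in> verts (G \<restriction> insert w S) - {r}"
    then show "(depth(w := Suc (depth u))) v = Suc ((depth(w := Suc (depth u))) ((par(w := u)) v))"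
      using S.depth_par[of v] parS[of v] w by auto
  qed
qed

text \<open>
  A maximal vertex set whose induced subgraph can be rooted at \<open>r\<close> is the whole vertex set, since
  by connectivity an edge would leave any smaller one, and its far end could be added.
\<close>

lemma (in graph) acyclic_imp_rooting:
  assumes acyclic: "\<not> (\<exists>p. cycle p \<and> 3 \<le> length p)"
    and conn: "strongly_connected G" and r: "r \<in> verts G"
  obtains par depth where "rooted_digraph G r par depth"
proof -
  define rooted where "rooted S \<longleftrightarrow> S \<subseteq> verts G \<and> (\<exists>par depth. rooted_digraph (G \<restriction> S) r par depth)" for S
  have "rooted_digraph (G \<restriction> {r}) r id (\<lambda>_. 0)"
    by (intro rooted_digraph.intro rooted_digraph_axioms.intro wellformed_induce_subgraph)
      (auto simp: arcs_ends_conv dest!: no_loops)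
  then have "rooted {r}" using r by (auto simp: rooted_def)
  moreover have "finite {S. rooted S}"
    by (rule finite_subset[of _ "Pow (verts G)"]) (auto simp: rooted_def)
  ultimately obtain S where S: "rooted S" "\<And>S'. rooted S' \<Longrightarrow> S \<subseteq> S' \<Longrightarrow> S = S'"
    using finite_has_maximal2[of "{S. rooted S}" "{r}"] by auto
  then obtain par depth where rd: "S \<subseteq> verts G" "rooted_digraph (G \<restriction> S) r par depth"
    by (auto simp: rooted_def)
  have "r \<in> S" using rooted_digraph.root_in_verts[OF rd(2)] by simp
  have "S = verts G"
  proof (rule ccontr)
    assume "S \<noteq> verts G"
    then obtain v where "v \<in> verts G" "v \<notin> S" using rd by blast
    moreover have "r \<rightarrow>\<^sup>* v" using conn r calculation by (auto simp: strongly_connected_def)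
    ultimately obtain u w where uw: "u \<in> S" "w \<notin> S" "u \<rightarrow> w"
      using reachable_leaves_set \<open>r \<in> S\<close> by metis
    then have "rooted (insert w S)"
      using extend_rooting[OF acyclic rd uw] rd adj_in_verts by (auto simp: rooted_def)
    then show False using S(2)[of "insert w S"] uw by blast
  qed
  moreover have "G \<restriction> verts G = G"
    by (rule pre_digraph.equality) auto
  ultimately show ?thesis using rd that by simp
qed

text \<open>
  A vertex of maximal depth has no children.  This supplies the leaf at which the tree is rooted
  for the colouring; if the tree has only one vertex, it is that vertex.
\<close>

lemma (in rooted_digraph) deepest_at_most_one_neighbour:
  assumes "finite (verts G)"
  obtains l where "l \<in> verts G" "\<And>u v. l \<rightarrow> u \<Longrightarrow> l \<rightarrow> v \<Longrightarrow> u = v"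
proof -
  define l where "l = (ARG_MAX depth v. v \<in> verts G)"
  have l: "l \<in> verts G" "\<And>v. v \<in> verts G \<Longrightarrow> depth v \<le> depth l"
    using arg_max_nat_lemma[of "\<lambda>v. v \<in> verts G" root depth "Suc (Max (depth ` verts G))"]
      root_in_verts assms
    by (auto simp: l_def less_Suc_eq_le)
  have "u = par l" if "l \<rightarrow> u" for u
    using that adj_iff[of l u] depth_par[of u] l(2)[of u] by auto
  then show ?thesis using l(1) that by metis
qed

section \<open>Colouring\<close>

text \<open>
  The entries of a palette are the colours of the vertex itself, of its parent, of its
  grandparent, and the spare fourth colour.
\<close>

type_synonym palette = "nat \<times> nat \<times> nat \<times> nat"

text \<open>
  A child inherits its second and third entry from its parent; the heir takes the spare colour and
  leaves the colour of its great-grandparent spare, any other child does the opposite.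
\<close>

fun pass_on :: "bool \<Rightarrow> palette \<Rightarrow> palette" where
  "pass_on True (a, b, c, d) = (d, a, b, c)"
| "pass_on False (a, b, c, d) = (c, a, b, d)"

text \<open>
  The root has no parent to contribute a colour, so with two children it need not see all four
  colours.  Rooting at a leaf excludes this case.
\<close>

locale leaf_rooted_graph = graph G + rooted_digraph G root par depth
  for G :: "('a, 'b) pre_digraph" (structure) and root par depth +
  assumes root_leaf: "root \<rightarrow> u \<Longrightarrow> root \<rightarrow> v \<Longrightarrow> u = v"
begin

definition child :: "'a \<Rightarrow> 'a \<Rightarrow> bool" where
  "child u v \<longleftrightarrow> v \<in> verts G - {root} \<and> par v = u"

definition heir :: "'a \<Rightarrow> 'a" where
  "heir u = (SOME v. child u v)"

text \<open>Recursion on the depth replaces recursion along the parent function.\<close>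

primrec palette_at :: "nat \<Rightarrow> 'a \<Rightarrow> palette" where
  "palette_at 0 v = (1, 2, 3, 4)"
| "palette_at (Suc n) v = pass_on (v = heir (par v)) (palette_at n (par v))"

definition palette :: "'a \<Rightarrow> palette" where
  "palette v = palette_at (depth v) v"

definition colour :: "'a \<Rightarrow> nat" where
  "colour v = fst (palette v)"

lemma palette_child:
  assumes "child u v"
  shows "palette v = pass_on (v = heir u) (palette u)"
  using assms depth_par[of v] by (auto simp: child_def palette_def)

lemma child_heir: "child u v \<Longrightarrow> child u (heir u)"
  unfolding heir_def by (rule someI)

lemma adj_child_iff: "u \<rightarrow> v \<longleftrightarrow> child u v \<or> child v u"
  using adj_iff[of u v] by (auto simp: child_def)

lemma child_par: "v \<in> verts G \<Longrightarrow> v \<noteq> root \<Longrightarrow> child (par v) v"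
  by (simp add: child_def)

lemma child_neq: "child u v \<Longrightarrow> u \<noteq> v"
  using depth_par[of v] by (auto simp: child_def)

lemma set_palette:
  assumes "v \<in> verts G" "palette v = (a, b, c, d)"
  shows "{a, b, c, d} = {1..4}"
  using assms
proof (induction arbitrary: a b c d rule: root_induct)
  case root
  then show ?case by (auto simp: palette_def depth_root)
next
  case (par v)
  obtain a' b' c' d' where p: "palette (par v) = (a', b', c', d')" by (metis prod.exhaust)
  have "palette v = pass_on (v = heir (par v)) (palette (par v))"
    using palette_child child_par par by blast
  then have "{a, b, c, d} = {a', b', c', d'}"
    using par.prems p by (cases "v = heir (par v)") auto
  then show ?case using par.IH[OF p] by simp
qed

lemma distinct_palette:
  assumes "v \<in> verts G" "palette v = (a, b, c, d)"
  shows "distinct [a, b, c, d]"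
proof -
  have "card (set [a, b, c, d]) = length [a, b, c, d]"
    using set_palette[OF assms] by simp
  then show ?thesis by (rule card_distinct)
qed

lemma palette_par:
  assumes "child u v" "palette v = (a, b, c, d)"
  shows "colour u = b"
proof -
  obtain a' b' c' d' where "palette u = (a', b', c', d')" by (metis prod.exhaust)
  then show ?thesis
    using palette_child[OF assms(1)] assms(2) by (cases "v = heir u") (auto simp: colour_def)
qed

lemma palette_grandpar:
  assumes "child t u" "child u v" "palette v = (a, b, c, d)"
  shows "colour t = c"
proof -
  obtain a' b' c' d' where p: "palette u = (a', b', c', d')" by (metis prod.exhaust)
  then have "c = b'"
    using palette_child[OF assms(2)] assms(3) by (cases "v = heir u") auto
  then show ?thesis using palette_par[OF assms(1) p] by simp
qed

lemma colour_range: "v \<in> verts G \<Longrightarrow> colour v \<in> {1..4}"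
  using set_palette[of v] by (cases "palette v") (auto simp: colour_def)

lemma colour_child_neq:
  assumes "child u v"
  shows "colour u \<noteq> colour v"
proof -
  obtain a b c d where p: "palette v = (a, b, c, d)" by (metis prod.exhaust)
  have "v \<in> verts G" using assms by (simp add: child_def)
  then show ?thesis
    using distinct_palette[OF _ p] palette_par[OF assms p] p by (auto simp: colour_def)
qed

lemma colour_proper: "u \<rightarrow> v \<Longrightarrow> colour u \<noteq> colour v"
  using colour_child_neq adj_child_iff by metis

text \<open>
  The four colours are those of the parent, of the vertex, of its heir, and of any other child;
  of the two given children at least one is not the heir.
\<close>

lemma colours_at_branching:
  assumes "child t u" "child u v" "child u w" "v \<noteq> w"
  shows "\<exists>v w. child u v \<and> child u w \<and> {colour t, colour u, colour v, colour w} = {1..4}"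
proof -
  obtain v' where v': "child u v'" "v' \<noteq> heir u" using assms by metis
  note h = child_heir[OF v'(1)]
  obtain a b c d where p: "palette u = (a, b, c, d)" by (metis prod.exhaust)
  have "colour u = a" "colour t = b" "colour (heir u) = d" "colour v' = c"
    using p palette_par[OF assms(1) p] palette_child[OF h] palette_child[OF v'(1)] v'(2)
    by (auto simp: colour_def)
  moreover have "{a, b, c, d} = {1..4}"
    using set_palette[OF _ p] assms(1) by (simp add: child_def)
  ultimately have "{colour t, colour u, colour (heir u), colour v'} = {1..4}" by auto
  then show ?thesis using h v'(1) by blast
qed

text \<open>
  An heir takes the spare colour in the palette of its parent, and the other three entries of
  that palette are the colours of its next three ancestors.
\<close>

lemma colours_along_chain:
  assumes "child s t" "child t u" "child u v" "v = heir u"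
  shows "{colour s, colour t, colour u, colour v} = {1..4}"
proof -
  obtain a b c d where p: "palette u = (a, b, c, d)" by (metis prod.exhaust)
  have "colour u = a" "colour t = b" "colour s = c" "colour v = d"
    using p palette_par[OF assms(2) p] palette_grandpar[OF assms(1,2) p]
      palette_child[OF assms(3)] assms(4)
    by (auto simp: colour_def)
  moreover have "{a, b, c, d} = {1..4}"
    using set_palette[OF _ p] assms(2) by (simp add: child_def)
  ultimately show ?thesis by auto
qed

text \<open>
  A colour is missing from \<open>seen A\<close> exactly when \<open>A\<close> avoids the closed neighbourhood of its class.
\<close>

definition seen :: "'a set \<Rightarrow> nat set" where
  "seen A = {colour v | v. v \<in> A \<or> (\<exists>u\<in>A. v \<rightarrow> u)}"

lemma seen_branching:
  assumes "u \<in> A" "u \<noteq> root" "child u v" "child u w" "v \<noteq> w"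
  shows "{1..4} \<subseteq> seen A"
proof -
  have "u \<in> verts G" using assms(3) adj_child_iff adj_in_verts by blast
  then have t: "child (par u) u" using assms(2) child_par by blast
  obtain v' w' where c: "child u v'" "child u w'"
    and all: "{colour (par u), colour u, colour v', colour w'} = {1..4}"
    using colours_at_branching[OF t assms(3-5)] by blast
  have "{colour (par u), colour u, colour v', colour w'} \<subseteq> seen A"
    using assms(1) t c unfolding seen_def by (auto simp: adj_child_iff)
  then show ?thesis using all by simp
qed

text \<open>
  The four consecutive vertices needed for \<open>colours_along_chain\<close> are found by prolonging the chain
  at its top or at its bottom.  If neither is possible, nothing hangs off the chain.
\<close>

lemma seen_chain:
  assumes "child s t" "child t u"
    and narrow: "\<And>a v w. a \<in> {s, t, u} \<Longrightarrow> child a v \<Longrightarrow> child a w \<Longrightarrow> v = w"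
  shows "{1..4} \<subseteq> seen {s, t, u} \<or> verts G = {s, t, u}"
proof -
  have heir: "v = heir a" if "a \<in> {s, t, u}" "child a v" for a v
    using narrow that child_heir by blast
  consider (up) "s \<noteq> root" | (down) v where "child u v" | (stop) "s = root" "\<nexists>v. child u v"
    by blast
  then show ?thesis
  proof cases
    case up
    have "s \<in> verts G" using assms(1) adj_child_iff adj_in_verts by blast
    then have r: "child (par s) s" using up child_par by blast
    have "{colour (par s), colour s, colour t, colour u} \<subseteq> seen {s, t, u}"
      using r unfolding seen_def by (auto simp: adj_child_iff)
    then show ?thesis using colours_along_chain[OF r assms(1,2)] heir[of t u] assms(2) by simp
  next
    case down
    have "{colour s, colour t, colour u, colour v} \<subseteq> seen {s, t, u}"
      using down unfolding seen_def by (auto simp: adj_child_iff)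
    then show ?thesis using colours_along_chain[OF assms(1,2) down] heir[of u v] down by simp
  next
    case stop
    have "v \<in> {s, t, u}" if "v \<in> verts G" for v
      using that
    proof (induction rule: root_induct)
      case root
      then show ?case using stop by simp
    next
      case (par v)
      have v: "child (par v) v" using child_par par by blast
      from par.IH consider "par v = s" | "par v = t" | "par v = u" by blast
      then show ?case
      proof cases
        case 1
        then show ?thesis using narrow[of s v t] v assms(1) by simp
      next
        case 2
        then show ?thesis using narrow[of t v u] v assms(2) by simp
      next
        case 3
        then show ?thesis using v stop(2) by blast
      qed
    qed
    then have "verts G \<subseteq> {s, t, u}" by (rule subsetI)
    moreover have "{s, t, u} \<subseteq> verts G"
      using assms(1,2) root_in_verts stop(1) by (simp add: child_def)
    ultimately show ?thesis by (intro disjI2 equalityI)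
  qed
qed

text \<open>
  Without a branching vertex, the middle vertex of the path cannot have both ends as children.
  As it has only one parent, one end is its parent and the other its child.
\<close>

lemma seen_three_vertex_path:
  assumes path: "distinct [x, y, z]" "x \<rightarrow> y" "y \<rightarrow> z"
  shows "{1..4} \<subseteq> seen {x, y, z} \<or> verts G = {x, y, z}"
proof (cases "\<exists>a v w. a \<in> {x, y, z} \<and> a \<noteq> root \<and> child a v \<and> child a w \<and> v \<noteq> w")
  case True
  then obtain a v w where "a \<in> {x, y, z}" "a \<noteq> root" "child a v" "child a w" "v \<noteq> w"
    by (elim exE conjE)
  then show ?thesis by (intro disjI1 seen_branching)
next
  case False
  have narrow: "v = w" if "a \<in> {x, y, z}" "child a v" "child a w" for a v w
  proof (cases "a = root")
    case True
    then show ?thesis using root_leaf that(2,3) adj_child_iff by simp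
  next
    case nonroot: False
    show ?thesis using False nonroot that by (metis (no_types))
  qed
  have "\<not> (child x y \<and> child z y)" using path(1) by (auto simp: child_def)
  moreover have "\<not> (child y x \<and> child y z)" using narrow[of y x z] path(1) by auto
  ultimately consider "child x y" "child y z" | "child z y" "child y x"
    using path(2,3) adj_child_iff by blast
  then show ?thesis
  proof cases
    case 1
    then show ?thesis using narrow by (rule seen_chain)
  next
    case 2
    have same: "{z, y, x} = {x, y, z}" by auto
    have "{1..4} \<subseteq> seen {z, y, x} \<or> verts G = {z, y, x}"
      by (rule seen_chain[OF 2]) (rule narrow, simp_all only: same)
    then show ?thesis by (simp only: same)
  qed
qed

lemma star_coloring_colour: "star_coloring G 4 colour"
  using colour_range colour_proper
  by (fastforce simp: star_coloring_def independent_set_def color_class_def)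

lemma all_isolating_colour:
  assumes no_P3: "\<not> digraph_iso G (with_proj (path_graph 3))" and "i \<in> {1..4}"
  shows "all_isolating G 3 (color_class G colour i)"
  unfolding all_isolating_def
proof (intro conjI notI)
  show "color_class G colour i \<subseteq> verts G" by (auto simp: color_class_def)
next
  define W where "W = verts G - closed_nbhd G (color_class G colour i)"
  assume "\<exists>H\<in>pre_digraph.sccs (G \<restriction> (verts G - closed_nbhd G (color_class G colour i))).
            3 \<le> card (verts H)"
  then obtain H where H: "induced_subgraph H (G \<restriction> W)" "strongly_connected H" "3 \<le> card (verts H)"
    unfolding W_def pre_digraph.sccs_def by blast
  have W: "induced_subgraph (G \<restriction> W) G" by (rule induced_induce) (auto simp: W_def)
  have "wf_digraph H" using H(1) by (auto simp: induced_subgraph_def subgraph_def)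
  moreover have "symmetric H"
    using induced_graph_imp_symmetric H(1) W sym_arcs by blast
  ultimately obtain x y z where xyz: "distinct [x, y, z]" "x \<rightarrow>\<^bsub>H\<^esub> y" "y \<rightarrow>\<^bsub>H\<^esub> z"
    using strongly_connected_imp_three_vertex_path H by metis
  have "subgraph H (G \<restriction> W)" using H(1) by auto
  then have "x \<rightarrow>\<^bsub>G \<restriction> W\<^esub> y" "y \<rightarrow>\<^bsub>G \<restriction> W\<^esub> z"
    using xyz pre_digraph.adj_mono by fast+
  then have path: "x \<rightarrow> y" "y \<rightarrow> z" and inW: "{x, y, z} \<subseteq> W"
    by (auto simp: adj_induce_subgraph_iff)
  have "verts G \<noteq> {x, y, z}"
    using no_P3 path_graph_3_isoI[OF _ _ xyz(1) path no_triangle[OF path]] graph_axioms by blast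
  then have "i \<in> seen {x, y, z}"
    using seen_three_vertex_path[OF xyz(1) path] assms(2) by blast
  then obtain v where v: "colour v = i" "v \<in> {x, y, z} \<or> (\<exists>u\<in>{x, y, z}. v \<rightarrow> u)"
    by (auto simp: seen_def)
  then have "v \<in> color_class G colour i"
    using inW adj_in_verts by (auto simp: color_class_def W_def)
  then show False using v(2) inW by (auto simp: W_def closed_nbhd_def)
qed

end

theorem theorem5:
  fixes T :: "('a, 'b) pre_digraph"
  assumes "simple_tree T"
    and "\<not> digraph_iso T (with_proj (path_graph 3))"
  shows "\<exists>c. star_coloring T 4 c \<and> (\<forall>i \<in> {1..4}. all_isolating T 3 (color_class T c i))"
proof -
  interpret graph T using assms(1) by (simp add: simple_tree_def)
  have acyclic: "\<not> (\<exists>p. cycle p \<and> 3 \<le> length p)"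
    using assms(1) by (simp add: simple_tree_def)
  have conn: "strongly_connected T"
    using assms(1) symmetric_connected_imp_strongly_connected sym_arcs
    by (simp add: simple_tree_def)
  obtain r where "r \<in> verts T" using conn by (auto simp: strongly_connected_def)
  then obtain par\<^sub>0 depth\<^sub>0 where "rooted_digraph T r par\<^sub>0 depth\<^sub>0"
    using acyclic_imp_rooting[OF acyclic conn] by blast
  then obtain l where l: "l \<in> verts T" "\<And>u v. l \<rightarrow>\<^bsub>T\<^esub> u \<Longrightarrow> l \<rightarrow>\<^bsub>T\<^esub> v \<Longrightarrow> u = v"
    using rooted_digraph.deepest_at_most_one_neighbour finite_verts by metis
  obtain par depth where "rooted_digraph T l par depth"
    using acyclic_imp_rooting[OF acyclic conn l(1)] by blast
  then interpret leaf_rooted_graph T l par depth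
    using graph_axioms l(2)
    by (intro leaf_rooted_graph.intro leaf_rooted_graph_axioms.intro)
  show ?thesis using star_coloring_colour all_isolating_colour[OF assms(2)] by blast
qed

end
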